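(* Let $(X,\mathcal{S})$ be an $S$-metric space, let $x_0\in X$, $r\in(0,\infty)$, and let $C_{x_0,r}^{S}$ be the circle centered at $x_0$ with radius $r$. Define $\varphi:X\to[0,\infty)$ by $\varphi(x)=\mathcal{S}(x,x,x_0)$ for all $x\in X$. Let $T:X\to X$ be a self-mapping satisfying $$\mathcal{S}(x,x,Tx)\leq \varphi(x)+\varphi(Tx)-2r$$ and $$\mathcal{S}(x,x,Tx)+\mathcal{S}(Tx,Tx,x_0)\leq r$$ for all $x\in C_{x_0,r}^{S}$. If the contractive condition $$\mathcal{S}(Tx,Tx,Ty)<\max\{\mathcal{S}(x,x,y),\ \mathcal{S}(Tx,Tx,x),\ \mathcal{S}(Ty,Ty,y),\ \mathcal{S}(Ty,Ty,x),\ \mathcal{S}(Tx,Tx,y)\}$$ is satisfied by $T$ for all $x\in C_{x_0,r}^{S}$ and $y\in X\setminus C_{x_0,r}^{S}$, then $C_{x_0,r}^{S}$ is the unique fixed circle of $T$.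
   Context: An $S$-metric on a nonempty set $X$ is a function $\mathcal{S}:X^3\to[0,\infty)$ such that for all $x,y,z,a\in X$: (1) $\mathcal{S}(x,y,z)=0$ if and only if $x=y=z$; (2) $\mathcal{S}(x,y,z)\leq \mathcal{S}(x,x,a)+\mathcal{S}(y,y,a)+\mathcal{S}(z,z,a)$. The pair $(X,\mathcal{S})$ is then called an $S$-metric space. For $x_0\in X$ and $r\in(0,\infty)$, the circle centered at $x_0$ with radius $r$ is $C_{x_0,r}^{S}=\{x\in X:\mathcal{S}(x,x,x_0)=r\}$. For a self-mapping $T:X\to X$, a circle $C_{x_0,r}^{S}$ is said to be a fixed circle of $T$ if $Tx=x$ for all $x\in C_{x_0,r}^{S}$.
   Formalization: The circle is assumed nonempty, and uniqueness is asserted only among fixed circles not properly contained in it (i.e. every fixed circle lies inside it), since the literal claim fails for empty circles and for smaller circles inside the fixed circle. *)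

theory Defs
  imports Complex_Main "HOL-Library.FuncSet"
begin

locale S_metric_space =
  fixes X :: "'a set" and S :: "'a \<Rightarrow> 'a \<Rightarrow> 'a \<Rightarrow> real"
  assumes nonempty: "X \<noteq> {}"
    and nonneg: "\<lbrakk>x \<in> X; y \<in> X; z \<in> X\<rbrakk> \<Longrightarrow> 0 \<le> S x y z"
    and eq_zero_iff: "\<lbrakk>x \<in> X; y \<in> X; z \<in> X\<rbrakk> \<Longrightarrow> S x y z = 0 \<longleftrightarrow> x = y \<and> y = z"
    and triangle: "\<lbrakk>x \<in> X; y \<in> X; z \<in> X; a \<in> X\<rbrakk>
          \<Longrightarrow> S x y z \<le> S x x a + S y y a + S z z a"

definition S_circle :: "'a set \<Rightarrow> ('a \<Rightarrow> 'a \<Rightarrow> 'a \<Rightarrow> real) \<Rightarrow> 'a \<Rightarrow> real \<Rightarrow> 'a set"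
  where "S_circle X S x0 r = {x \<in> X. S x x x0 = r}"

(* A circle may be empty, or a proper subset of a circle with another centre, and every circle
   contained in a fixed circle is itself fixed.  Uniqueness of a fixed circle is therefore
   asserted only against fixed circles that are not properly contained in it. *)
definition fixed_circle ::
    "'a set \<Rightarrow> ('a \<Rightarrow> 'a \<Rightarrow> 'a \<Rightarrow> real) \<Rightarrow> ('a \<Rightarrow> 'a) \<Rightarrow> 'a \<Rightarrow> real \<Rightarrow> bool"
  where "fixed_circle X S T x0 r \<longleftrightarrow>
    x0 \<in> X \<and> 0 < r \<and> (\<forall>x \<in> S_circle X S x0 r. T x = x)"

end

theory Submission
  imports Defs
begin

text \<open>
  On the circle \<open>\<phi>\<close> equals \<open>r\<close>, so the two fixing conditions bound \<open>S x x (T x)\<close> by a quantity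
  and by its negative, namely by \<open>\<phi> (T x) - r\<close> and \<open>r - \<phi> (T x)\<close>; hence it vanishes.

  For uniqueness, a second fixed circle that is not contained in the first one carries a fixed
  point \<open>y\<close> off the first circle, and the contractive condition compares it with a point \<open>x\<close> of the
  first circle. For two fixed points, all five entries of the maximum are \<open>0\<close>, \<open>S x x y\<close> or
  \<open>S y y x\<close>. Since \<open>S x x y\<close> is symmetric in \<open>x\<close> and \<open>y\<close>, the maximum is the left-hand side itself,
  which contradicts strictness.
\<close>

context S_metric_space
begin

text \<open>
  Choosing the first point as the auxiliary point of the triangle inequality makes two of its three
  terms vanish.
\<close>
lemma sym:
  assumes "x \<in> X" "y \<in> X"
  shows "S x x y = S y y x"
proof -
  have le: "S u u v \<le> S v v u" if "u \<in> X" "v \<in> X" for u v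
    using triangle[of u u v u] eq_zero_iff[of u u u] that by simp
  show ?thesis
    using le[of x y] le[of y x] assms by simp
qed

lemma no_contraction_between_fixed_points:
  assumes "x \<in> X" "y \<in> X" "T x = x" "T y = y"
  shows "\<not> S (T x) (T x) (T y) <
    Max {S x x y, S (T x) (T x) x, S (T y) (T y) y, S (T y) (T y) x, S (T x) (T x) y}"
  using assms nonneg[of x x y] eq_zero_iff[of x x x] eq_zero_iff[of y y y] sym[of x y]
  by simp

lemma fixed_point_on_circle:
  assumes x: "x \<in> S_circle X S x0 r" and Tx: "T x \<in> X"
    and outside: "S x x (T x) \<le> S x x x0 + S (T x) (T x) x0 - 2 * r"
    and inside: "S x x (T x) + S (T x) (T x) x0 \<le> r"
  shows "T x = x"
proof -
  have xX: "x \<in> X" and "S x x x0 = r"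
    using x by (auto simp: S_circle_def)
  then have "S x x (T x) = 0"
    using outside inside nonneg[of x x "T x"] Tx by linarith
  then show ?thesis
    using eq_zero_iff[of x x "T x"] xX Tx by simp
qed

end

theorem theorem3p4:
  fixes X :: "'a set" and S :: "'a \<Rightarrow> 'a \<Rightarrow> 'a \<Rightarrow> real"
    and x0 :: 'a and r :: real and \<phi> :: "'a \<Rightarrow> real" and T :: "'a \<Rightarrow> 'a"
  assumes "S_metric_space X S"
    and "x0 \<in> X" and "0 < r"
    and "S_circle X S x0 r \<noteq> {}"
    and "\<And>x. x \<in> X \<Longrightarrow> \<phi> x = S x x x0"
    and "T \<in> X \<rightarrow> X"
    and "\<And>x. x \<in> S_circle X S x0 r \<Longrightarrow> S x x (T x) \<le> \<phi> x + \<phi> (T x) - 2 * r"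
    and "\<And>x. x \<in> S_circle X S x0 r \<Longrightarrow> S x x (T x) + S (T x) (T x) x0 \<le> r"
    and "\<And>x y. x \<in> S_circle X S x0 r \<Longrightarrow> y \<in> X - S_circle X S x0 r \<Longrightarrow>
      S (T x) (T x) (T y) <
        Max {S x x y, S (T x) (T x) x, S (T y) (T y) y, S (T y) (T y) x, S (T x) (T x) y}"
  shows "fixed_circle X S T x0 r \<and>
    (\<forall>x1 \<rho>. fixed_circle X S T x1 \<rho> \<and> \<not> S_circle X S x1 \<rho> \<subset> S_circle X S x0 r
        \<longrightarrow> S_circle X S x1 \<rho> = S_circle X S x0 r)"
proof -
  interpret S_metric_space X S by fact
  let ?C = "S_circle X S x0 r"
  have CX: "?C \<subseteq> X" by (auto simp: S_circle_def)
  have fixed: "T x = x" if x: "x \<in> ?C" for x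
  proof (rule fixed_point_on_circle[OF x])
    show Tx: "T x \<in> X"
      using x CX assms(6) by blast
    show "S x x (T x) \<le> S x x x0 + S (T x) (T x) x0 - 2 * r"
      using assms(7)[OF x] assms(5)[of x] assms(5)[OF Tx] x CX by auto
    show "S x x (T x) + S (T x) (T x) x0 \<le> r"
      using assms(8)[OF x] .
  qed
  have no_fixed_point_off: "T y \<noteq> y" if y: "y \<in> X - ?C" for y
  proof
    assume "T y = y"
    moreover obtain x where x: "x \<in> ?C"
      using assms(4) by blast
    ultimately show False
      using no_contraction_between_fixed_points[of x y T] assms(9)[OF x y] fixed[OF x] y CX
      by blast
  qed
  have "S_circle X S x1 \<rho> \<subseteq> ?C" if "fixed_circle X S T x1 \<rho>" for x1 \<rho>
    using that no_fixed_point_off by (auto simp: fixed_circle_def S_circle_def)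
  then show ?thesis
    using fixed assms(2,3) by (auto simp: fixed_circle_def)
qed

end
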